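(* VG implies DF. That is, if $\delta(V_n,V)\to 0$ as $n\to\infty$, then there is $C>0$ such that for all $n$ and all $v\in V_n$, $|v|^2\le C\,a(v,v)$.
   Context: Setting. $O$ is an infinite dimensional separable real Hilbert space with scalar product $\langle\cdot,\cdot\rangle$ and norm $|\cdot|$. $X\subseteq O$ is a dense subspace, itself a Hilbert space with continuous inclusion $X\to O$. $a$ is a continuous symmetric bilinear form on $X$ with $a(u,u)\ge 0$ for all $u\in X$, such that $\langle\cdot,\cdot\rangle+a$ is coercive on $X$; this form is taken as the scalar product of $X$, so $\|u\|^2=|u|^2+a(u,u)$ is the norm of $X$. Define $W=\{u\in X: a(u,u')=0\ \forall u'\in X\}$ and $V=\{u\in X:\langle u,w\rangle=0\ \forall w\in W\}$, so $X=V\oplus W$. $W$ may be infinite dimensional. It is assumed that the injection $V\to O$ is compact ($V$ carrying the norm of $X$). Discretization. $(X_n)_{n\in\mathbb N}$ is a sequence of finite dimensional subspaces of $X$ satisfying AS: for all $u\in X$, $\lim_{n\to\infty}\inf_{u'\in X_n}\|u-u'\|=0$. Define $W_n=\{u\in X_n: a(u,u')=0\ \forall u'\in X_n\}=X_n\cap W$ and $V_n=\{u\in X_n:\langle u,w\rangle=0\ \forall w\in W_n\}$, so $X_n=V_n\oplus W_n$ ($V_n$ need not be contained in $V$). Gap. For subspaces $U,U'$ of $X$, $\delta(U,U')=\sup_{u\in U, u\neq0}\inf_{u'\in U'}\|u-u'\|/\|u\|$ (supremum over the empty set being $0$). *)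

theory Defs
  imports "HOL-Analysis.Analysis"
begin

text \<open>
  The dense subspace \<open>X \<subseteq> O\<close> carries its own Hilbert space topology. It is therefore a type \<open>'x\<close>
  of its own, with an injective inclusion map \<open>\<iota>\<close> into the Hilbert space \<open>'o\<close> that plays the role
  of \<open>O\<close>: for \<open>u :: 'x\<close>, \<open>norm u\<close> is the norm of \<open>X\<close> and \<open>norm (\<iota> u)\<close> is the norm of \<open>O\<close>.
\<close>

definition form_kernel :: "('x \<Rightarrow> 'x \<Rightarrow> real) \<Rightarrow> 'x set \<Rightarrow> 'x set"
  where "form_kernel a U = {u \<in> U. \<forall>u'\<in>U. a u u' = 0}"

text \<open>With \<open>U = UNIV\<close> the following two sets are \<open>W\<close> and \<open>V\<close>; with \<open>U = X\<^sub>n\<close> they are \<open>W\<^sub>n\<close> and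
  \<open>V\<^sub>n\<close>. Orthogonality is with respect to the scalar product of \<open>O\<close>.\<close>

definition kernel_complement ::
    "('x \<Rightarrow> 'o::real_inner) \<Rightarrow> ('x \<Rightarrow> 'x \<Rightarrow> real) \<Rightarrow> 'x set \<Rightarrow> 'x set"
  where "kernel_complement \<iota> a U = {u \<in> U. \<forall>w\<in>form_kernel a U. inner (\<iota> u) (\<iota> w) = 0}"

definition compact_map_on ::
    "'x::real_normed_vector set \<Rightarrow> ('x \<Rightarrow> 'o::metric_space) \<Rightarrow> bool"
  where "compact_map_on U f \<longleftrightarrow> (\<forall>B. B \<subseteq> U \<longrightarrow> bounded B \<longrightarrow> compact (closure (f ` B)))"

text \<open>For subspaces \<open>U'\<close> the quotients lie in \<open>[0, 1]\<close>, so the real-valued supremum is the genuine one.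
  The supremum over the empty set is set to \<open>0\<close> explicitly because real \<open>Sup {}\<close> is unspecified.\<close>

definition gap :: "'x::real_normed_vector set \<Rightarrow> 'x set \<Rightarrow> real"
  where "gap U U' = (if U \<subseteq> {0} then 0 else (SUP u\<in>U - {0}. infdist u U' / norm u))"

locale form_space =
  fixes \<iota> :: "'x::{real_inner,complete_space} \<Rightarrow> 'o::{real_inner,complete_space}"
    and a :: "'x \<Rightarrow> 'x \<Rightarrow> real"
  assumes infinite_dim: "\<nexists>B :: 'o set. finite B \<and> span B = UNIV"
    and separable: "separable_space (euclidean :: 'o topology)"
    and bounded_linear_inclusion: "bounded_linear \<iota>"
    and inj_inclusion: "inj \<iota>"
    and dense_inclusion: "closure (range \<iota>) = UNIV"
    and bounded_bilinear_form: "bounded_bilinear a"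
    and form_sym: "a u v = a v u"
    and form_nonneg: "0 \<le> a u u"
      \<comment> \<open>The scalar product of \<open>O\<close> plus \<open>a\<close> is the scalar product of \<open>X\<close>; in particular it is
        coercive on \<open>X\<close>, with constant \<open>1\<close>.\<close>
    and inner_form: "inner u v = inner (\<iota> u) (\<iota> v) + a u v"
    and compact_inclusion: "compact_map_on (kernel_complement \<iota> a UNIV) \<iota>"

locale galerkin_approximation = form_space \<iota> a
  for \<iota> :: "'x::{real_inner,complete_space} \<Rightarrow> 'o::{real_inner,complete_space}"
    and a :: "'x \<Rightarrow> 'x \<Rightarrow> real" +
  fixes X :: "nat \<Rightarrow> 'x set"
  assumes finite_dim_subspace: "\<exists>B. finite B \<and> X n = span B"
    and approximating: "(\<lambda>n. infdist u (X n)) \<longlonglongrightarrow> 0"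

end

theory Submission
  imports Defs
begin

text \<open>
  On a closed linear subspace \<open>U\<close> of \<open>X\<close> for which the inclusion of the kernel complement into \<open>O\<close>
  is compact, a normalized sequence with \<open>a v v \<rightarrow> 0\<close> has a subsequence converging in \<open>X\<close>; its limit
  lies both in the kernel and in its complement, so it vanishes, which is absurd. This gives the
  Friedrichs inequality on \<open>V\<close> and on each single \<open>V\<^sub>n\<close>, the latter because \<open>X\<^sub>n\<close> is
  finite dimensional. For large \<open>n\<close> every \<open>v \<in> V\<^sub>n\<close> is close, relative to its norm, to an element of
  \<open>V\<close>, so the inequality on \<open>V\<close> transfers to \<open>V\<^sub>n\<close> with a constant independent of \<open>n\<close>; the finitely
  many remaining \<open>n\<close> are handled one by one.
\<close>

section \<open>Compactness of balls in finite dimensional subspaces\<close>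

lemma compact_span_Int_cball_orthogonal:
  fixes C :: "'x::real_inner set"
  assumes "finite C" and "pairwise orthogonal C"
  shows "compact (span C \<inter> cball 0 r)"
  using assms
proof (induction C rule: finite_induct)
  case empty
  have "{0::'x} \<inter> cball 0 r \<in> {{}, {0}}" by auto
  then show ?case by auto
next
  case (insert c C)
  have IH: "compact (span C \<inter> cball 0 r)"
    using insert by (auto simp: pairwise_insert)
  have orth: "inner c y = 0" if "y \<in> span C" for y
  proof -
    have "orthogonal c y"
      using insert by (intro orthogonal_to_span[OF that]) (auto simp: pairwise_insert)
    then show ?thesis by (simp add: orthogonal_def)
  qed
  \<comment> \<open>By Pythagoras, both components of a vector of the ball have norm at most
    \<open>r\<close>, which bounds the coefficient of \<open>c\<close> by \<open>r / norm c\<close>.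
    For \<open>c = 0\<close> the division yields \<open>0\<close>, and the segment is still
    \<open>{0}\<close>.\<close>
  define D where "D = {x + y | x y. x \<in> (\<lambda>t. t *\<^sub>R c) ` {-r/norm c..r/norm c} \<and> y \<in> span C \<inter> cball 0 r}"
  have "compact D"
    unfolding D_def
    by (intro compact_sums IH compact_continuous_image continuous_intros) auto
  \<comment> \<open>The summands of \<open>D\<close> are bounded separately, so \<open>D\<close> may
    leave the ball; cutting with the closed ball again preserves compactness.\<close>
  moreover have "span (insert c C) \<inter> cball 0 r = D \<inter> cball 0 r"
  proof (intro equalityI subsetI)
    fix x assume x: "x \<in> span (insert c C) \<inter> cball 0 r"
    then obtain t where t: "x - t *\<^sub>R c \<in> span C" by (auto simp: span_insert)
    define y where "y = x - t *\<^sub>R c"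
    have xeq: "x = t *\<^sub>R c + y" by (simp add: y_def)
    have y: "y \<in> span C" using t by (simp add: y_def)
    have pyth: "(norm x)\<^sup>2 = (norm (t *\<^sub>R c))\<^sup>2 + (norm y)\<^sup>2"
      unfolding xeq using orth[OF y]
      by (simp add: power2_norm_eq_inner inner_add_left inner_add_right inner_commute del: norm_scaleR)
    have xr: "norm x \<le> r" using x by auto
    have "norm y \<le> norm x" by (rule power2_le_imp_le) (use pyth in auto)
    then have yr: "norm y \<le> r" using xr by simp
    have "norm (t *\<^sub>R c) \<le> norm x" by (rule power2_le_imp_le) (use pyth in auto)
    then have tr: "\<bar>t\<bar> * norm c \<le> r" using xr by simp
    have "t *\<^sub>R c \<in> (\<lambda>t. t *\<^sub>R c) ` {-r/norm c..r/norm c}"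
    proof (cases "c = 0")
      case True
      then show ?thesis by force
    next
      case False
      then have "\<bar>t\<bar> \<le> r / norm c" using tr by (simp add: field_simps)
      then show ?thesis by (intro imageI) auto
    qed
    then have "x \<in> D" unfolding D_def using xeq y yr by auto
    then show "x \<in> D \<inter> cball 0 r" using x by auto
  next
    fix x assume "x \<in> D \<inter> cball 0 r"
    then show "x \<in> span (insert c C) \<inter> cball 0 r"
      unfolding D_def by (auto simp: span_insert)
        (metis add_diff_cancel_left')
  qed
  ultimately show ?case by (simp add: compact_Int_closed)
qed

lemma compact_finite_span_Int_cball:
  fixes B :: "'x::real_inner set"
  assumes "finite B"
  shows "compact (span B \<inter> cball 0 r)"
proof -
  obtain C where "finite C" "span C = span B" "pairwise orthogonal C"
    using basis_orthogonal[OF assms] by blast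
  then show ?thesis using compact_span_Int_cball_orthogonal[of C r] by simp
qed

lemma closed_finite_span:
  fixes B :: "'x::real_inner set"
  assumes "finite B"
  shows "closed (span B)"
  unfolding closed_sequential_limits
proof (intro allI impI, elim conjE)
  fix x l assume x: "\<forall>n. x n \<in> span B" and lim: "x \<longlonglongrightarrow> l"
  obtain r where "\<And>n. norm (x n) \<le> r"
    using convergent_imp_bounded[OF lim] by (auto simp: bounded_iff)
  then have "\<forall>n. x n \<in> span B \<inter> cball 0 r" using x by auto
  then show "l \<in> span B"
    using closed_sequentially[OF compact_imp_closed[OF compact_finite_span_Int_cball[OF assms]] _ lim]
    by blast
qed

text \<open>Supplies for the discrete complements the compactness that is assumed for the inclusion
  of \<open>V\<close>.\<close>

lemma compact_map_on_finite_span: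
  fixes B :: "'x::real_inner set" and f :: "'x \<Rightarrow> 'o::metric_space"
  assumes "finite B" and "U \<subseteq> span B" and "continuous_on (span B) f"
  shows "compact_map_on U f"
  unfolding compact_map_on_def
proof (intro allI impI)
  fix S assume S: "S \<subseteq> U" "bounded S"
  then obtain r where "\<forall>x\<in>S. norm x \<le> r" by (auto simp: bounded_iff)
  then have sub: "f ` S \<subseteq> f ` (span B \<inter> cball 0 r)" using S assms(2) by auto
  have "compact (f ` (span B \<inter> cball 0 r))"
    by (intro compact_continuous_image compact_finite_span_Int_cball assms(1)
        continuous_on_subset[OF assms(3)]) auto
  then have "closure (f ` S) \<subseteq> f ` (span B \<inter> cball 0 r)"
    using sub by (simp add: closure_minimal compact_imp_closed)
  with \<open>compact (f ` (span B \<inter> cball 0 r))\<close> show "compact (closure (f ` S))"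
    using compact_Int_closed[of "f ` (span B \<inter> cball 0 r)" "closure (f ` S)"]
    by (simp add: inf.absorb2)
qed

text \<open>Since \<open>0 \<in> U'\<close>, the quotients are at most \<open>1\<close>, so the real
  supremum really is an upper bound for them.\<close>

lemma infdist_le_gap:
  assumes "0 \<in> U'" and "u \<in> U" and "u \<noteq> 0"
  shows "infdist u U' \<le> gap U U' * norm u"
proof -
  have "infdist x U' / norm x \<le> 1" if "x \<noteq> 0" for x
    using infdist_le[OF assms(1), of x] that by (simp add: divide_le_eq)
  then have "bdd_above ((\<lambda>u. infdist u U' / norm u) ` (U - {0}))"
    by (intro bdd_aboveI2[where M = 1]) auto
  then have "infdist u U' / norm u \<le> (SUP u\<in>U - {0}. infdist u U' / norm u)"
    using assms by (intro cSUP_upper) auto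
  moreover have "\<not> U \<subseteq> {0}" using assms by auto
  ultimately show ?thesis using assms(3) by (simp add: gap_def divide_le_eq)
qed

section \<open>The Friedrichs inequality on closed subspaces\<close>

context form_space
begin

interpretation A: bounded_bilinear a by (rule bounded_bilinear_form)
interpretation I: bounded_linear \<iota> by (rule bounded_linear_inclusion)

lemma norm_form: "(norm u)\<^sup>2 = (norm (\<iota> u))\<^sup>2 + a u u"
  using inner_form[of u u] by (simp add: power2_norm_eq_inner)

lemma form_le_norm: "a u u \<le> (norm u)\<^sup>2"
  using norm_form[of u] by simp

lemma form_add_le: "a (u + v) (u + v) \<le> 2 * a u u + 2 * a v v"
  using form_nonneg[of "u - v"] form_sym[of u v]
  by (simp add: A.add_left A.add_right A.diff_left A.diff_right)

lemma form_diff_le: "a (u - v) (u - v) \<le> 2 * a u u + 2 * a v v"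
  using form_add_le[of u "- v"] by (simp add: A.minus_left A.minus_right)

text \<open>The degenerate case of Cauchy-Schwarz for a semidefinite form: along
  \<open>w + t *\<^sub>R u\<close> the form is affine in \<open>t\<close>, so a nonzero slope would
  make it negative somewhere.\<close>

lemma form_eq_0:
  assumes "a u u = 0"
  shows "a u w = 0"
proof (rule ccontr)
  assume ne: "a u w \<noteq> 0"
  define t where "t = - (a w w + 1) / (2 * a u w)"
  have "0 \<le> a (w + t *\<^sub>R u) (w + t *\<^sub>R u)" by (rule form_nonneg)
  also have "\<dots> = a w w + 2 * t * a u w"
    using assms form_sym[of w u]
    by (simp add: A.add_left A.add_right A.scaleR_left A.scaleR_right)
  also have "\<dots> = -1" using ne by (simp add: t_def field_simps)
  finally show False by simp
qed

lemma kernel_complement_scaleR: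
  assumes "subspace U" and "u \<in> kernel_complement \<iota> a U"
  shows "c *\<^sub>R u \<in> kernel_complement \<iota> a U"
  using assms by (auto simp: kernel_complement_def subspace_scale I.scaleR)

lemma closed_kernel_complement:
  assumes "closed U"
  shows "closed (kernel_complement \<iota> a U)"
proof -
  have "closed {u. inner (\<iota> u) (\<iota> w) = 0}" for w
    by (intro closed_Collect_eq continuous_intros I.continuous_on)
  moreover have "kernel_complement \<iota> a U = U \<inter> (\<Inter>w\<in>form_kernel a U. {u. inner (\<iota> u) (\<iota> w) = 0})"
    by (auto simp: kernel_complement_def)
  ultimately show ?thesis using assms by auto
qed

text \<open>Such a \<open>u\<close> also lies in the kernel, hence is orthogonal to itself in the
  scalar product of \<open>O\<close>.\<close>

lemma kernel_complement_definite:
  assumes "u \<in> kernel_complement \<iota> a U" and "a u u = 0"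
  shows "u = 0"
proof -
  have "u \<in> form_kernel a U"
    using assms form_eq_0 by (auto simp: form_kernel_def kernel_complement_def)
  then have "\<iota> u = 0" using assms by (auto simp: kernel_complement_def)
  then show ?thesis using norm_form[of u] assms(2) by simp
qed

text \<open>Compactness makes a subsequence Cauchy in the norm of \<open>O\<close>; the vanishing
  form controls the rest of the norm of \<open>X\<close>, and completeness of \<open>X\<close> gives
  the limit.\<close>

lemma convergent_subseq_form_0:
  fixes v :: "nat \<Rightarrow> 'x"
  assumes cpt: "compact_map_on V \<iota>" and v: "\<And>k. v k \<in> V" and bnd: "\<And>k. norm (v k) \<le> R"
    and av: "(\<lambda>k. a (v k) (v k)) \<longlonglongrightarrow> 0"
  obtains l s where "strict_mono s" and "(v \<circ> s) \<longlonglongrightarrow> l"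
proof -
  have "bounded (range v)" using bnd by (auto simp: bounded_iff)
  then have "compact (closure (\<iota> ` range v))"
    using cpt v unfolding compact_map_on_def by blast
  moreover have "\<forall>k. \<iota> (v k) \<in> closure (\<iota> ` range v)"
    using closure_subset by fastforce
  ultimately obtain m s where s: "strict_mono s" and m: "((\<lambda>k. \<iota> (v k)) \<circ> s) \<longlonglongrightarrow> m"
    unfolding compact_def by (metis (no_types, lifting))
  have as: "(\<lambda>k. a (v (s k)) (v (s k))) \<longlonglongrightarrow> 0"
    using LIMSEQ_subseq_LIMSEQ[OF av s] by (simp add: o_def)
  have "Cauchy (v \<circ> s)"
  proof (rule metric_CauchyI)
    fix e :: real assume e: "0 < e"
    have "Cauchy ((\<lambda>k. \<iota> (v k)) \<circ> s)" using m by (rule LIMSEQ_imp_Cauchy)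
    then obtain M where M: "\<And>i j. i \<ge> M \<Longrightarrow> j \<ge> M \<Longrightarrow> dist (\<iota> (v (s i))) (\<iota> (v (s j))) < e / 2"
      using e unfolding Cauchy_def by (metis comp_apply half_gt_zero)
    \<comment> \<open>\<open>form_diff_le\<close> doubles two such values to \<open>e^2 / 2\<close>;
      with \<open>e^2 / 4\<close> from the norm of \<open>O\<close> the sum stays below
      \<open>e^2\<close>.\<close>
    have "eventually (\<lambda>k. a (v (s k)) (v (s k)) < e\<^sup>2 / 8) sequentially"
      using as e by (intro order_tendstoD) auto
    then obtain N where N: "\<And>k. k \<ge> N \<Longrightarrow> a (v (s k)) (v (s k)) < e\<^sup>2 / 8"
      by (auto simp: eventually_sequentially)
    have "dist ((v \<circ> s) i) ((v \<circ> s) j) < e" if "i \<ge> max M N" "j \<ge> max M N" for i j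
    proof -
      let ?d = "v (s i) - v (s j)"
      have "norm (\<iota> ?d) < e / 2" using M[of i j] that by (simp add: dist_norm I.diff)
      then have "(norm (\<iota> ?d))\<^sup>2 < (e / 2)\<^sup>2" by (intro power_strict_mono) auto
      then have "(norm (\<iota> ?d))\<^sup>2 < e\<^sup>2 / 4" by (simp add: power_divide)
      moreover have "a ?d ?d < e\<^sup>2 / 2"
        using form_diff_le[of "v (s i)" "v (s j)"] N[of i] N[of j] that by simp
      ultimately have "(norm ?d)\<^sup>2 < e\<^sup>2"
        using norm_form[of ?d] zero_less_power[OF e, of 2] by linarith
      then show ?thesis using e by (simp add: dist_norm power_less_imp_less_base)
    qed
    then show "\<exists>M. \<forall>m\<ge>M. \<forall>n\<ge>M. dist ((v \<circ> s) m) ((v \<circ> s) n) < e" by blast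
  qed
  then obtain l where "(v \<circ> s) \<longlonglongrightarrow> l" using Cauchy_convergent convergent_def by blast
  with s that show ?thesis by blast
qed

text \<open>The left side carries the norm of \<open>X\<close>, not only that of \<open>O\<close>:
  this is the form needed for the transfer to nearby vectors.\<close>

lemma friedrichs:
  assumes U: "subspace U" "closed U" and cpt: "compact_map_on (kernel_complement \<iota> a U) \<iota>"
  shows "\<exists>C>0. \<forall>v\<in>kernel_complement \<iota> a U. (norm v)\<^sup>2 \<le> C * a v v"
proof (rule ccontr)
  let ?V = "kernel_complement \<iota> a U"
  assume "\<not> ?thesis"
  then have "\<exists>v\<in>?V. (norm v)\<^sup>2 > real (Suc k) * a v v" for k
    by (metis not_le of_nat_0_less_iff zero_less_Suc)
  then obtain w where w: "\<And>k. w k \<in> ?V" "\<And>k. (norm (w k))\<^sup>2 > real (Suc k) * a (w k) (w k)"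
    by metis
  have w0: "norm (w k) > 0" for k
    using w(2)[of k] by (cases "w k = 0") (auto simp: A.zero_left)
  define v where "v k = (1 / norm (w k)) *\<^sub>R w k" for k
  have v: "v k \<in> ?V" for k
    unfolding v_def by (rule kernel_complement_scaleR[OF U(1) w(1)])
  have nv: "norm (v k) = 1" for k using w0[of k] by (simp add: v_def)
  have small: "a (v k) (v k) \<le> inverse (real (Suc k))" for k
  proof -
    have "a (v k) (v k) = a (w k) (w k) / (norm (w k))\<^sup>2"
      by (simp add: v_def A.scaleR_left A.scaleR_right power2_eq_square)
    also have "\<dots> \<le> inverse (real (Suc k))"
      using w(2)[of k] w0[of k] by (simp add: field_simps)
    finally show ?thesis .
  qed
  have av: "(\<lambda>k. a (v k) (v k)) \<longlonglongrightarrow> 0"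
    by (rule tendsto_sandwich[OF _ _ tendsto_const LIMSEQ_inverse_real_of_nat])
       (use small form_nonneg in auto)
  obtain l s where s: "strict_mono s" and l: "(v \<circ> s) \<longlonglongrightarrow> l"
    using convergent_subseq_form_0[OF cpt v _ av, of 1] nv by (metis order_refl)
  \<comment> \<open>The limit inherits membership from closedness and \<open>a l l = 0\<close> from
    continuity, yet has norm \<open>1\<close>.\<close>
  have "l \<in> ?V"
    using closed_sequentially[OF closed_kernel_complement[OF U(2)] _ l] v by simp
  moreover have "a l l = 0"
  proof (rule LIMSEQ_unique)
    show "(\<lambda>k. a ((v \<circ> s) k) ((v \<circ> s) k)) \<longlonglongrightarrow> a l l" using l l by (rule A.tendsto)
    show "(\<lambda>k. a ((v \<circ> s) k) ((v \<circ> s) k)) \<longlonglongrightarrow> 0"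
      using LIMSEQ_subseq_LIMSEQ[OF av s] by (simp add: o_def)
  qed
  ultimately have "l = 0" by (rule kernel_complement_definite)
  moreover have "norm l = 1"
    using tendsto_norm[OF l] nv by (simp add: LIMSEQ_const_iff)
  ultimately show False by simp
qed

text \<open>Passing from \<open>v\<close> to a nearby \<open>v'\<close> in \<open>V\<close> and back
  costs \<open>(4 * K + 2) * (norm ?d)^2\<close>. The condition on \<open>e\<close> makes this at
  most half of \<open>(norm v)^2\<close>; absorbing it on the left doubles \<open>4 * K\<close> to
  \<open>8 * K\<close>.\<close>

lemma friedrichs_transfer:
  assumes K: "K > 0" and V: "V \<noteq> {}" "\<And>v. v \<in> V \<Longrightarrow> (norm v)\<^sup>2 \<le> K * a v v"
    and e: "e\<^sup>2 * (8 * K + 4) \<le> 1" and near: "infdist v V < e * norm v"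
  shows "(norm v)\<^sup>2 \<le> 8 * K * a v v"
proof -
  obtain v' where v': "v' \<in> V" and d: "dist v v' < e * norm v"
    \<comment> \<open>The infimum need not be attained; the strict inequality in \<open>near\<close>
      still provides a witness.\<close>
    using near V(1) by (metis infdist_notempty cINF_less_iff bdd_below_image_dist)
  let ?d = "v - v'"
  have "(norm ?d)\<^sup>2 \<le> (e * norm v)\<^sup>2"
    using d by (intro power_mono) (auto simp: dist_norm)
  then have d2: "(norm ?d)\<^sup>2 \<le> e\<^sup>2 * (norm v)\<^sup>2" by (simp add: power_mult_distrib)
  have "(norm v)\<^sup>2 \<le> (norm v' + norm ?d)\<^sup>2"
    using norm_triangle_ineq[of v' ?d] by (intro power_mono) auto
  also have "\<dots> \<le> 2 * (norm v')\<^sup>2 + 2 * (norm ?d)\<^sup>2"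
    using sum_squares_bound[of "norm v'" "norm ?d"] by (simp add: power2_sum)
  also have "(norm v')\<^sup>2 \<le> K * a v' v'" by (rule V(2)[OF v'])
  also have "a v' v' \<le> 2 * a v v + 2 * (norm ?d)\<^sup>2"
    using form_diff_le[of v ?d] form_le_norm[of ?d] by simp
  finally have "(norm v)\<^sup>2 \<le> 4 * K * a v v + (4 * K + 2) * (norm ?d)\<^sup>2"
    using K by (simp add: algebra_simps)
  also have "(4 * K + 2) * (norm ?d)\<^sup>2 \<le> (4 * K + 2) * (e\<^sup>2 * (norm v)\<^sup>2)"
    using K by (intro mult_left_mono d2) simp
  also have "\<dots> = (e\<^sup>2 * (8 * K + 4)) * (norm v)\<^sup>2 / 2"
    by (simp add: algebra_simps)
  finally have "(norm v)\<^sup>2 \<le> 4 * K * a v v + (e\<^sup>2 * (8 * K + 4)) * (norm v)\<^sup>2 / 2"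
    by simp
  moreover have "(e\<^sup>2 * (8 * K + 4)) * (norm v)\<^sup>2 \<le> (norm v)\<^sup>2"
    using mult_right_mono[OF e, of "(norm v)\<^sup>2"] by simp
  ultimately show ?thesis by linarith
qed

end

section \<open>A constant uniform in \<open>n\<close>\<close>

theorem proposition6:
  fixes \<iota> :: "'x::{real_inner,complete_space} \<Rightarrow> 'o::{real_inner,complete_space}"
    and a :: "'x \<Rightarrow> 'x \<Rightarrow> real"
    and X :: "nat \<Rightarrow> 'x set"
  assumes "galerkin_approximation \<iota> a X"
    and "(\<lambda>n. gap (kernel_complement \<iota> a (X n)) (kernel_complement \<iota> a UNIV)) \<longlonglongrightarrow> 0"
  shows "\<exists>C>0. \<forall>n. \<forall>v\<in>kernel_complement \<iota> a (X n). (norm (\<iota> v))\<^sup>2 \<le> C * a v v"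
proof -
  interpret galerkin_approximation \<iota> a X by (rule assms(1))
  interpret I: bounded_linear \<iota> by (rule bounded_linear_inclusion)
  let ?V = "kernel_complement \<iota> a UNIV" and ?Vn = "\<lambda>n. kernel_complement \<iota> a (X n)"
  obtain K where K: "K > 0" "\<And>v. v \<in> ?V \<Longrightarrow> (norm v)\<^sup>2 \<le> K * a v v"
    using friedrichs[OF subspace_UNIV closed_UNIV compact_inclusion] by blast
  have "\<exists>C>0. \<forall>v\<in>?Vn n. (norm v)\<^sup>2 \<le> C * a v v" for n
  proof -
    obtain B where B: "finite B" "X n = span B" using finite_dim_subspace by blast
    have "compact_map_on (?Vn n) \<iota>"
      using B by (intro compact_map_on_finite_span[of B])
        (auto simp: kernel_complement_def intro!: I.continuous_on continuous_intros)
    then show ?thesis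
      using B by (intro friedrichs) (auto simp: closed_finite_span)
  qed
  then obtain c where c: "\<And>n. c n > 0" "\<And>n v. v \<in> ?Vn n \<Longrightarrow> (norm v)\<^sup>2 \<le> c n * a v v"
    by metis
  \<comment> \<open>Chosen so that the smallness condition of \<open>friedrichs_transfer\<close>
    holds with equality.\<close>
  define e where "e = sqrt (1 / (8 * K + 4))"
  have e: "e > 0" "e\<^sup>2 * (8 * K + 4) \<le> 1" using K(1) by (auto simp: e_def)
  obtain N where N: "\<And>n. n \<ge> N \<Longrightarrow> gap (?Vn n) ?V < e"
    using order_tendstoD(2)[OF assms(2) e(1)] by (auto simp: eventually_sequentially)
  have V0: "0 \<in> ?V" by (simp add: kernel_complement_def I.zero)
  have tail: "(norm v)\<^sup>2 \<le> 8 * K * a v v" if "n \<ge> N" "v \<in> ?Vn n" for n v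
  proof (cases "v = 0")
    case True
    then show ?thesis using K(1) form_nonneg[of v] by simp
  next
    case False
    have "infdist v ?V \<le> gap (?Vn n) ?V * norm v" by (rule infdist_le_gap[OF V0 that(2) False])
    also have "\<dots> < e * norm v" using N[OF that(1)] False by simp
    finally show ?thesis using friedrichs_transfer[OF K(1) _ K(2) e(2)] V0 by blast
  qed
  \<comment> \<open>\<open>8 * K\<close> serves all \<open>n \<ge> N\<close>; the sum of positive
    constants dominates each \<open>c n\<close> with \<open>n < N\<close>.\<close>
  define C where "C = 8 * K + (\<Sum>n<N. c n)"
  have "(norm (\<iota> v))\<^sup>2 \<le> C * a v v" if v: "v \<in> ?Vn n" for n v
  proof -
    have sum: "0 \<le> (\<Sum>n<N. c n)" using c(1) by (intro sum_nonneg) (simp add: less_imp_le)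
    obtain D where D: "(norm v)\<^sup>2 \<le> D * a v v" "D \<le> C"
    proof (cases "n \<ge> N")
      case True
      then show ?thesis using that[of "8 * K"] tail[OF _ v] sum by (simp add: C_def)
    next
      case False
      have "c n \<le> (\<Sum>n<N. c n)"
        using False c(1) by (intro member_le_sum) (auto simp: less_imp_le)
      then show ?thesis using that[of "c n"] c(2)[OF v] K(1) by (simp add: C_def)
    qed
    \<comment> \<open>Only here is the norm of \<open>X\<close> weakened to that of
      \<open>O\<close>.\<close>
    have "(norm (\<iota> v))\<^sup>2 \<le> (norm v)\<^sup>2" using norm_form[of v] form_nonneg[of v] by simp
    also have "\<dots> \<le> D * a v v" by (rule D(1))
    also have "\<dots> \<le> C * a v v" by (rule mult_right_mono[OF D(2) form_nonneg])
    finally show ?thesis .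
  qed
  moreover have "C > 0"
    unfolding C_def using K(1) c(1) by (intro add_pos_nonneg sum_nonneg) (auto simp: less_imp_le)
  ultimately show ?thesis by blast
qed

end
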